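(* Let $X$ be a non-locally convex quasi-Banach space and let $I=[0,1]$. Then there exists a function $f:I\to X$ that is continuous and Riemann-integrable such that its average function $\operatorname{Ave}[f]:I\times I\to X$ is neither bounded nor separately continuous.
   Context: Quasi-Banach spaces are real: $X$ is a real vector space with a complete quasi-norm $\|\cdot\|$ (i.e. $\|x\|>0$ for $x\ne0$, $\|\alpha x\|=|\alpha|\|x\|$, $\|x+y\|\le\kappa(\|x\|+\|y\|)$ for some constant $\kappa\ge1$), with the vector topology induced by the quasi-norm; $X$ is non-locally convex if this topology is not locally convex (equivalently, $X$ is not isomorphic to a Banach space). A function $f:[a,b]\to X$ is Riemann-integrable if its Riemann sums over tagged partitions converge in $X$ as the mesh of the partition tends to $0$; the limit is $\int_a^b f(u)\,du$. A function that is Riemann-integrable on $I$ is Riemann-integrable on each compact subinterval. For $f:I\to X$ continuous and Riemann-integrable, the average function $\operatorname{Ave}[f]:I\times I\to X$ is defined by $$\operatorname{Ave}[f](s,t)=\begin{cases}\frac{1}{t-s}\int_s^t f(u)\,du, & 0\le s<t\le 1,\\ f(c), & 0\le s=t=c\le 1,\\ \frac{1}{s-t}\int_t^s f(u)\,du, & 0\le t<s\le 1.\end{cases}$$ It is bounded if $\sup_{0\le s,t\le1}\|\operatorname{Ave}[f](s,t)\|<\infty$; separately continuous if for all $s_0,t_0\in I$, $\lim_{s\to s_0}\operatorname{Ave}[f](s,t_0)=\lim_{t\to t_0}\operatorname{Ave}[f](s_0,t)=\operatorname{Ave}[f](s_0,t_0)$. *)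

theory Defs
  imports "HOL-Analysis.Analysis"
begin

definition quasi_norm :: "('a::real_vector \<Rightarrow> real) \<Rightarrow> bool" where
  "quasi_norm q \<longleftrightarrow>
     (\<forall>x. x \<noteq> 0 \<longrightarrow> q x > 0) \<and>
     (\<forall>a x. q (a *\<^sub>R x) = \<bar>a\<bar> * q x) \<and>
     (\<exists>\<kappa>\<ge>1. \<forall>x y. q (x + y) \<le> \<kappa> * (q x + q y))"

text \<open>The balls of a quasi-norm need not be open, but they are neighbourhoods of their centres
  in the following topology (see \<open>limitin_quasi_norm_topology\<close> below).\<close>

definition quasi_norm_topology :: "('a::real_vector \<Rightarrow> real) \<Rightarrow> 'a topology" where
  "quasi_norm_topology q =
     topology (\<lambda>U. \<forall>x\<in>U. \<exists>e>0. \<forall>y. q (y - x) < e \<longrightarrow> y \<in> U)"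

definition quasi_banach :: "('a::real_vector \<Rightarrow> real) \<Rightarrow> bool" where
  "quasi_banach q \<longleftrightarrow> quasi_norm q \<and>
     (\<forall>x::nat \<Rightarrow> 'a. (\<forall>e>0. \<exists>N. \<forall>m\<ge>N. \<forall>n\<ge>N. q (x m - x n) < e) \<longrightarrow>
        (\<exists>l. limitin (quasi_norm_topology q) x l sequentially))"

definition locally_convex :: "'a::real_vector topology \<Rightarrow> bool" where
  "locally_convex T \<longleftrightarrow> neighbourhood_base_of convex T"

text \<open>The filter of tagged partitions of \<open>{a..b}\<close> whose mesh tends to \<open>0\<close>. A tagged division in
  the sense of the library may contain one-point intervals; these contribute nothing to a
  Riemann sum.\<close>

definition mesh_filter :: "real \<Rightarrow> real \<Rightarrow> (real \<times> real set) set filter" where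
  "mesh_filter a b =
     (INF \<delta>\<in>{0<..}. principal {p. p tagged_division_of {a..b} \<and> (\<forall>(x, K)\<in>p. measure lborel K < \<delta>)})"

definition has_riemann_integral ::
    "'a::real_vector topology \<Rightarrow> (real \<Rightarrow> 'a) \<Rightarrow> 'a \<Rightarrow> real \<Rightarrow> real \<Rightarrow> bool" where
  "has_riemann_integral T f l a b \<longleftrightarrow>
     limitin T (\<lambda>p. \<Sum>(x, K)\<in>p. measure lborel K *\<^sub>R f x) l (mesh_filter a b)"

definition riemann_integrable ::
    "'a::real_vector topology \<Rightarrow> (real \<Rightarrow> 'a) \<Rightarrow> real \<Rightarrow> real \<Rightarrow> bool" where
  "riemann_integrable T f a b \<longleftrightarrow> (\<exists>l. has_riemann_integral T f l a b)"

definition riemann_integral ::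
    "'a::real_vector topology \<Rightarrow> (real \<Rightarrow> 'a) \<Rightarrow> real \<Rightarrow> real \<Rightarrow> 'a" where
  "riemann_integral T f a b = (THE l. has_riemann_integral T f l a b)"

definition Ave :: "'a::real_vector topology \<Rightarrow> (real \<Rightarrow> 'a) \<Rightarrow> real \<Rightarrow> real \<Rightarrow> 'a" where
  "Ave T f s t =
     (if s < t then (1 / (t - s)) *\<^sub>R riemann_integral T f s t
      else if s = t then f s
      else (1 / (s - t)) *\<^sub>R riemann_integral T f t s)"

definition bounded_on_square :: "('a \<Rightarrow> real) \<Rightarrow> (real \<Rightarrow> real \<Rightarrow> 'a) \<Rightarrow> bool" where
  "bounded_on_square q F \<longleftrightarrow> bdd_above ((\<lambda>(s, t). q (F s t)) ` ({0..1} \<times> {0..1}))"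

definition separately_continuous_on_square :: "'a topology \<Rightarrow> (real \<Rightarrow> real \<Rightarrow> 'a) \<Rightarrow> bool" where
  "separately_continuous_on_square T F \<longleftrightarrow>
     (\<forall>s\<^sub>0\<in>{0..1}. \<forall>t\<^sub>0\<in>{0..1}.
        limitin T (\<lambda>s. F s t\<^sub>0) (F s\<^sub>0 t\<^sub>0) (at s\<^sub>0 within {0..1}) \<and>
        limitin T (\<lambda>t. F s\<^sub>0 t) (F s\<^sub>0 t\<^sub>0) (at t\<^sub>0 within {0..1}))"

lemma openin_quasi_norm_topology:
  "openin (quasi_norm_topology q) U \<longleftrightarrow> (\<forall>x\<in>U. \<exists>e>0. \<forall>y. q (y - x) < e \<longrightarrow> y \<in> U)"
proof -
  have "istopology (\<lambda>U. \<forall>x\<in>U. \<exists>e>0. \<forall>y. q (y - x) < e \<longrightarrow> y \<in> U)"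
    unfolding istopology_def
  proof (intro conjI allI impI ballI)
    fix S T x
    assume S: "\<forall>x\<in>S. \<exists>e>0. \<forall>y. q (y - x) < e \<longrightarrow> y \<in> S"
      and T: "\<forall>x\<in>T. \<exists>e>0. \<forall>y. q (y - x) < e \<longrightarrow> y \<in> T" and x: "x \<in> S \<inter> T"
    obtain d where d: "d > 0" "\<forall>y. q (y - x) < d \<longrightarrow> y \<in> S" using S x by blast
    obtain e where e: "e > 0" "\<forall>y. q (y - x) < e \<longrightarrow> y \<in> T" using T x by blast
    show "\<exists>e>0. \<forall>y. q (y - x) < e \<longrightarrow> y \<in> S \<inter> T"
      using d e by (intro exI[of _ "min d e"]) auto
  next
    fix \<K> :: "'a set set" and x
    assume K: "\<forall>K\<in>\<K>. \<forall>x\<in>K. \<exists>e>0. \<forall>y. q (y - x) < e \<longrightarrow> y \<in> K" and "x \<in> \<Union>\<K>"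
    then obtain A where A: "A \<in> \<K>" "x \<in> A" by blast
    with K obtain e where "e > 0" "\<forall>y. q (y - x) < e \<longrightarrow> y \<in> A" by blast
    then show "\<exists>e>0. \<forall>y. q (y - x) < e \<longrightarrow> y \<in> \<Union>\<K>" using A by blast
  qed
  then show ?thesis
    unfolding quasi_norm_topology_def by (simp add: topology_inverse')
qed

lemma topspace_quasi_norm_topology [simp]: "topspace (quasi_norm_topology q) = UNIV"
proof -
  have "openin (quasi_norm_topology q) UNIV"
    unfolding openin_quasi_norm_topology using zero_less_one by blast
  then show ?thesis using openin_subset by blast
qed

lemma limitin_quasi_norm_topology:
  assumes "quasi_norm q"
  shows "limitin (quasi_norm_topology q) f l F \<longleftrightarrow> (\<forall>e>0. \<forall>\<^sub>F x in F. q (f x - l) < e)"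
proof
  assume lim: "limitin (quasi_norm_topology q) f l F"
  obtain \<kappa> where \<kappa>: "\<kappa> \<ge> 1" "\<And>x y. q (x + y) \<le> \<kappa> * (q x + q y)"
    using assms unfolding quasi_norm_def by blast
  show "\<forall>e>0. \<forall>\<^sub>F x in F. q (f x - l) < e"
  proof (intro allI impI)
    fix e :: real assume e: "e > 0"
    define U where "U = {y. \<exists>r>0. \<forall>z. q (z - y) < r \<longrightarrow> q (z - l) < e}"
    have "openin (quasi_norm_topology q) U"
      unfolding openin_quasi_norm_topology
    proof
      fix y assume "y \<in> U"
      then obtain r where r: "r > 0" "\<And>z. q (z - y) < r \<Longrightarrow> q (z - l) < e"
        unfolding U_def by blast
      define d where "d = r / (2 * \<kappa>)"
      have d: "d > 0" "\<kappa> * (d + d) = r" using r \<kappa> by (auto simp: d_def)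
      have "q (z - y) < r" if "q (w - y) < d" "q (z - w) < d" for w z
      proof -
        have "q (z - y) \<le> \<kappa> * (q (z - w) + q (w - y))"
          using \<kappa>(2)[of "z - w" "w - y"] by simp
        also have "\<dots> < \<kappa> * (d + d)" using that \<kappa>(1) by (intro mult_strict_left_mono) auto
        finally show ?thesis using d by simp
      qed
      then have "\<forall>w. q (w - y) < d \<longrightarrow> w \<in> U"
        unfolding U_def using r d by blast
      then show "\<exists>e>0. \<forall>w. q (w - y) < e \<longrightarrow> w \<in> U" using d by blast
    qed
    moreover have "l \<in> U" unfolding U_def using e by blast
    ultimately have "\<forall>\<^sub>F x in F. f x \<in> U" using lim unfolding limitin_def by blast
    moreover have "q (y - l) < e" if "y \<in> U" for y
    proof -
      have "q (0 *\<^sub>R 0 :: 'a) = 0"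
        using assms unfolding quasi_norm_def by (metis abs_zero mult_zero_left)
      with that show ?thesis unfolding U_def by force
    qed
    ultimately show "\<forall>\<^sub>F x in F. q (f x - l) < e" by (auto elim: eventually_mono)
  qed
next
  assume R: "\<forall>e>0. \<forall>\<^sub>F x in F. q (f x - l) < e"
  show "limitin (quasi_norm_topology q) f l F"
    unfolding limitin_def openin_quasi_norm_topology
  proof (intro conjI allI impI)
    fix U assume "(\<forall>x\<in>U. \<exists>e>0. \<forall>y. q (y - x) < e \<longrightarrow> y \<in> U) \<and> l \<in> U"
    then obtain e where "e > 0" "\<forall>y. q (y - l) < e \<longrightarrow> y \<in> U" by blast
    then show "\<forall>\<^sub>F x in F. f x \<in> U" using R by (metis (mono_tags, lifting) eventually_mono)
  qed simp
qed

lemma eventually_mesh_filter: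
  "eventually P (mesh_filter a b) \<longleftrightarrow>
     (\<exists>\<delta>>0. \<forall>p. p tagged_division_of {a..b} \<and> (\<forall>(x, K)\<in>p. measure lborel K < \<delta>) \<longrightarrow> P p)"
  unfolding mesh_filter_def
proof (subst eventually_INF_base, goal_cases)
  case (2 c d)
  show ?case
  proof (rule bexI[of _ "min c d"])
    show "min c d \<in> {0<..}" using 2 by simp
  qed (auto simp: case_prod_beta)
qed (auto simp: eventually_principal intro: gt_ex)

end

theory Submission
  imports Defs
begin

text \<open>If \<open>X\<close> is not locally convex, convex combinations of vectors of small quasi-norm can have
  arbitrarily large quasi-norm. Hence there are continuous functions with values in a
  finite-dimensional space, uniformly small, supported in a tiny interval around a point \<open>m\<close>, with
  integral zero, but with a large integral up to \<open>m\<close>. Adding such blocks around points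
  \<open>m\<^sub>k \<rightarrow> 0\<close> gives a continuous \<open>f\<close>. The Riemann sums of the \<open>k\<close>-th block are bounded, uniformly
  over all partitions, by a geometrically decaying quantity (intervals of the partition inside the
  supporting interval form an absolutely convex combination, and at most two intervals stick out),
  so the blocks can be integrated term by term. The scales are chosen such that the integral of
  \<open>f\<close> over \<open>[0, m\<^sub>k]\<close> has quasi-norm \<open>2\<^sup>k m\<^sub>k\<close>.\<close>

section \<open>Scalar functions\<close>

text \<open>The hat function with support \<open>[0, 2]\<close> and peak 1 at 1, written as a second
  difference of the absolute value so that a primitive is available in closed form.\<close>

definition tent :: "real \<Rightarrow> real" where
  "tent t = (\<bar>t\<bar> + \<bar>t - 2\<bar> - 2 * \<bar>t - 1\<bar>) / 2"

text \<open>A combination of translates of \<open>t * \<bar>t\<bar>\<close>, whose derivative is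
  \<open>2 * \<bar>t\<bar>\<close>; the constant 1/2 makes it vanish to the left of 0.\<close>

definition tent_primitive :: "real \<Rightarrow> real" where
  "tent_primitive t = (t * \<bar>t\<bar> + (t - 2) * \<bar>t - 2\<bar> - 2 * ((t - 1) * \<bar>t - 1\<bar>)) / 4 + 1 / 2"

lemma has_real_derivative_times_abs:
  fixes t :: real
  shows "((\<lambda>t. t * \<bar>t\<bar>) has_real_derivative 2 * \<bar>t\<bar>) (at t)"
proof (cases "t = 0")
  case True
  have "((\<lambda>h::real. \<bar>h\<bar>) \<longlongrightarrow> 0) (at 0)"
    by (rule tendsto_eq_intros refl | simp)+
  moreover have "\<forall>\<^sub>F h in at (0::real). \<bar>h\<bar> = (h * \<bar>h\<bar>) / h"
    by (auto simp: eventually_at_filter)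
  ultimately have "((\<lambda>h::real. (h * \<bar>h\<bar>) / h) \<longlongrightarrow> 0) (at 0)"
    by (rule Lim_transform_eventually)
  then show ?thesis using True by (simp add: DERIV_def)
next
  case False
  have square: "((\<lambda>u. sgn t * (u * u)) has_real_derivative 2 * \<bar>t\<bar>) (at t)"
    by (auto intro!: derivative_eq_intros simp: abs_sgn)
  have eq: "\<forall>\<^sub>F u in nhds t. sgn t * (u * u) = u * \<bar>u\<bar>"
  proof -
    have "\<forall>\<^sub>F u in nhds t. u \<in> ball t \<bar>t\<bar>" using False by (intro eventually_nhds_in_open) auto
    then show ?thesis by eventually_elim (auto simp: dist_real_def sgn_if)
  qed
  show ?thesis using square DERIV_cong_ev[OF refl eq refl] by blast
qed

lemma has_real_derivative_tent_primitive:
  "(tent_primitive has_real_derivative tent t) (at t)"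
proof -
  have shift: "((\<lambda>t. (t - c) * \<bar>t - c\<bar>) has_real_derivative 2 * \<bar>t - c\<bar>) (at t)" for c
    using DERIV_shift[of "\<lambda>t. t * \<bar>t\<bar>" "2 * \<bar>t - c\<bar>" t "- c"] has_real_derivative_times_abs[of "t - c"]
    by simp
  show ?thesis
    unfolding tent_primitive_def [abs_def] tent_def
    by (rule derivative_eq_intros has_real_derivative_times_abs shift refl | simp)+
qed

lemma tent_outside: "t \<le> 0 \<or> t \<ge> 2 \<Longrightarrow> tent t = 0"
  by (auto simp: tent_def)

lemma abs_tent_le: "\<bar>tent t\<bar> \<le> 1"
  by (auto simp: tent_def abs_if)

lemma tent_primitive_le: "t \<le> 0 \<Longrightarrow> tent_primitive t = 0"
  by (simp add: tent_primitive_def abs_if algebra_simps)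

lemma tent_primitive_ge: "t \<ge> 2 \<Longrightarrow> tent_primitive t = 1"
  by (simp add: tent_primitive_def abs_if algebra_simps)

lemma continuous_tent: "continuous_on A tent"
  unfolding tent_def [abs_def] by (intro continuous_intros) simp

text \<open>The model is a row of hats side by side, starting at 0: the one for \<open>v\<close> has
  height \<open>sgn (s v)\<close> and a base of length \<open>\<bar>s v\<bar>\<close>, hence signed
  area \<open>s v / 2\<close>. The last clause expresses that no two of them are nonzero at the same
  point.\<close>

definition disjoint_bumps ::
  "'i set \<Rightarrow> ('i \<Rightarrow> real) \<Rightarrow> ('i \<Rightarrow> real \<Rightarrow> real) \<Rightarrow> ('i \<Rightarrow> real \<Rightarrow> real) \<Rightarrow> bool"
where
  "disjoint_bumps S s \<Psi> \<psi> \<longleftrightarrow>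
    (\<forall>v\<in>S. \<forall>t. (\<Psi> v has_real_derivative \<psi> v t) (at t)) \<and>
    (\<forall>v\<in>S. continuous_on UNIV (\<psi> v)) \<and>
    (\<forall>v\<in>S. \<forall>t. \<bar>\<psi> v t\<bar> \<le> 1) \<and>
    (\<forall>v\<in>S. \<forall>t\<le>0. \<psi> v t = 0 \<and> \<Psi> v t = 0) \<and>
    (\<forall>v\<in>S. \<forall>t\<ge>\<Sum>v\<in>S. \<bar>s v\<bar>. \<psi> v t = 0 \<and> \<Psi> v t = s v / 2) \<and>
    (\<forall>t. \<exists>u. \<forall>v\<in>S - {u}. \<psi> v t = 0)"

text \<open>Induction on \<open>S\<close>: the new hat starts at \<open>A\<close>, where all earlier
  ones have ended.\<close>

lemma disjoint_bumps_exist: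
  assumes "finite S"
  shows "\<exists>\<Psi> \<psi>. disjoint_bumps S s \<Psi> \<psi>"
  using assms
proof (induction S)
  case empty
  show ?case by (simp add: disjoint_bumps_def)
next
  case (insert i S)
  define A where "A = (\<Sum>v\<in>S. \<bar>s v\<bar>)"
  have A: "A \<ge> 0" unfolding A_def by (simp add: sum_nonneg)
  obtain \<Psi> \<psi> where "disjoint_bumps S s \<Psi> \<psi>" using insert.IH by blast
  then have IH:
    "\<And>v t. v \<in> S \<Longrightarrow> (\<Psi> v has_real_derivative \<psi> v t) (at t)"
    "\<And>v. v \<in> S \<Longrightarrow> continuous_on UNIV (\<psi> v)"
    "\<And>v t. v \<in> S \<Longrightarrow> \<bar>\<psi> v t\<bar> \<le> 1"
    "\<And>v t. v \<in> S \<Longrightarrow> t \<le> 0 \<Longrightarrow> \<psi> v t = 0 \<and> \<Psi> v t = 0"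
    "\<And>v t. v \<in> S \<Longrightarrow> t \<ge> A \<Longrightarrow> \<psi> v t = 0 \<and> \<Psi> v t = s v / 2"
    "\<And>t. \<exists>u. \<forall>v\<in>S - {u}. \<psi> v t = 0"
    unfolding disjoint_bumps_def A_def by blast+
  \<comment> \<open>The base of the new hat, from \<open>A\<close> to
    \<open>A + \<bar>s i\<bar>\<close>, is mapped affinely onto \<open>[0, 2]\<close>. If
    \<open>s i = 0\<close>, the factors \<open>sgn (s i)\<close> and \<open>s i / 2\<close> make the
    new functions zero.\<close>
  define w where "w t = 2 / \<bar>s i\<bar> * (t - A)" for t
  define \<psi>i where "\<psi>i t = sgn (s i) * tent (w t)" for t
  define \<Psi>i where "\<Psi>i t = s i / 2 * tent_primitive (w t)" for t
  have new_deriv: "(\<Psi>i has_real_derivative \<psi>i t) (at t)" for t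
  proof (cases "s i = 0")
    case True
    then show ?thesis by (simp add: \<Psi>i_def [abs_def] \<psi>i_def)
  next
    case False
    have "((\<lambda>t. t - A) has_real_derivative 1) (at t)"
      by (auto intro!: derivative_eq_intros)
    from DERIV_cmult[OF this, of "2 / \<bar>s i\<bar>"]
    have "(w has_real_derivative 2 / \<bar>s i\<bar>) (at t)"
      by (simp add: w_def [abs_def])
    from DERIV_chain2[OF has_real_derivative_tent_primitive this]
    have "(\<Psi>i has_real_derivative s i / 2 * (tent (w t) * (2 / \<bar>s i\<bar>))) (at t)"
      unfolding \<Psi>i_def [abs_def] by (rule DERIV_cmult)
    moreover have "s i / 2 * (tent (w t) * (2 / \<bar>s i\<bar>)) = \<psi>i t"
      using False by (cases "s i > 0") (auto simp: \<psi>i_def)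
    ultimately show ?thesis by simp
  qed
  have new_cont: "continuous_on UNIV \<psi>i"
    unfolding \<psi>i_def [abs_def] w_def [abs_def]
    by (cases "s i = 0") (auto intro!: continuous_intros continuous_on_compose2[OF continuous_tent])
  have new_bound: "\<bar>\<psi>i t\<bar> \<le> 1" for t
    using abs_tent_le[of "w t"] by (simp add: \<psi>i_def abs_mult sgn_if)
  have new_left: "\<psi>i t = 0 \<and> \<Psi>i t = 0" if "t \<le> A" for t
  proof -
    have "w t \<le> 0" using that by (simp add: w_def divide_le_0_iff mult_le_0_iff)
    then show ?thesis by (simp add: \<psi>i_def \<Psi>i_def tent_outside tent_primitive_le)
  qed
  have new_right: "\<psi>i t = 0 \<and> \<Psi>i t = s i / 2" if "t \<ge> \<bar>s i\<bar> + A" for t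
  proof (cases "s i = 0")
    case False
    then have "w t \<ge> 2" using that by (simp add: w_def field_simps)
    then show ?thesis by (simp add: \<psi>i_def \<Psi>i_def tent_outside tent_primitive_ge)
  qed (simp add: \<psi>i_def \<Psi>i_def)
  have sep: "\<exists>u. \<forall>v\<in>insert i S - {u}. (\<psi>(i := \<psi>i)) v t = 0" for t
  proof (cases "t \<le> A")
    case True
    obtain u where "\<forall>v\<in>S - {u}. \<psi> v t = 0" using IH(6) by blast
    then show ?thesis using new_left[OF True] by (intro exI[of _ u]) auto
  next
    case False
    then show ?thesis using IH(5)[of _ t] by (intro exI[of _ i]) auto
  qed
  have sum: "(\<Sum>v\<in>insert i S. \<bar>s v\<bar>) = \<bar>s i\<bar> + A"
    using insert.hyps by (simp add: A_def)
  show ?case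
    unfolding disjoint_bumps_def sum
  proof (rule exI[of _ "\<Psi>(i := \<Psi>i)"], rule exI[of _ "\<psi>(i := \<psi>i)"], intro conjI)
    show "\<forall>t. \<exists>u. \<forall>v\<in>insert i S - {u}. (\<psi>(i := \<psi>i)) v t = 0"
      using sep by blast
  qed (use IH new_deriv new_cont new_bound new_left new_right A in auto)
qed

section \<open>Scalar Riemann sums and tagged divisions\<close>

lemma measure_lborel_tagged:
  fixes a b :: real
  assumes "p tagged_division_of {a..b}" "(x, K) \<in> p"
  obtains c d where "K = {c..d}" "c \<le> x" "x \<le> d" "a \<le> c" "d \<le> b" "measure lborel K = d - c"
proof -
  obtain c d where K: "K = cbox c d"
    using tagged_division_ofD(4)[OF assms] by blast
  have "x \<in> K" "K \<subseteq> {a..b}"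
    using tagged_division_ofD(2,3)[OF assms] by auto
  with K show ?thesis by (intro that[of c d]) auto
qed

text \<open>By uniform continuity, each term of a fine Riemann sum differs from the integral over
  its interval by at most \<open>r\<close> times the length, and the lengths add up to
  \<open>b - a\<close>.\<close>

lemma riemann_sums_tendsto_integral:
  fixes \<phi> :: "real \<Rightarrow> real"
  assumes cont: "continuous_on {a..b} \<phi>" and ab: "a \<le> b"
  shows "((\<lambda>p. \<Sum>(x, K)\<in>p. measure lborel K * \<phi> x) \<longlongrightarrow> integral {a..b} \<phi>) (mesh_filter a b)"
proof (rule tendstoI)
  fix e :: real assume e: "e > 0"
  \<comment> \<open>Adding 1 keeps the denominator positive when \<open>a = b\<close> and makes
    \<open>r * (b - a) < e\<close> strict.\<close>
  define r where "r = e / (b - a + 1)"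
  have r: "r > 0" "r * (b - a) < e"
    using e ab by (auto simp: r_def field_simps)
  have "uniformly_continuous_on {a..b} \<phi>"
    using cont by (simp add: compact_uniformly_continuous)
  then obtain \<delta> where \<delta>: "\<delta> > 0"
    "\<And>x y. x \<in> {a..b} \<Longrightarrow> y \<in> {a..b} \<Longrightarrow> \<bar>y - x\<bar> < \<delta> \<Longrightarrow> \<bar>\<phi> y - \<phi> x\<bar> < r"
    using r(1) unfolding uniformly_continuous_on_def dist_real_def by metis
  show "\<forall>\<^sub>F p in mesh_filter a b. dist (\<Sum>(x, K)\<in>p. measure lborel K * \<phi> x) (integral {a..b} \<phi>) < e"
    unfolding eventually_mesh_filter
  proof (intro exI[of _ \<delta>] conjI allI impI \<delta>(1))
    fix p assume p: "p tagged_division_of {a..b} \<and> (\<forall>(x, K)\<in>p. measure lborel K < \<delta>)"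
    have int: "\<phi> integrable_on {a..b}" using cont by (rule integrable_continuous_real)
    have "integral {a..b} \<phi> = (\<Sum>(x, K)\<in>p. integral K \<phi>)"
      using integral_combine_tagged_division_topdown[of \<phi> a b p] int p by simp
    then have "dist (\<Sum>(x, K)\<in>p. measure lborel K * \<phi> x) (integral {a..b} \<phi>)
        = \<bar>\<Sum>(x, K)\<in>p. measure lborel K * \<phi> x - integral K \<phi>\<bar>"
      by (simp add: dist_real_def sum_subtractf case_prod_beta)
    also have "\<dots> \<le> (\<Sum>(x, K)\<in>p. measure lborel K * r)"
    proof (rule sum_abs[THEN order_trans], rule sum_mono, clarify)
      fix x K assume xK: "(x, K) \<in> p"
      then obtain c d where K: "K = {c..d}" "c \<le> x" "x \<le> d" "a \<le> c" "d \<le> b" "measure lborel K = d - c"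
        using p measure_lborel_tagged by metis
      have small: "d - c < \<delta>" using p xK K(6) by auto
      have intK: "\<phi> integrable_on {c..d}"
        using int K by (meson integrable_subinterval_real atLeastatMost_subset_iff)
      have "norm (integral {c..d} (\<lambda>y. \<phi> x - \<phi> y)) \<le> r * (d - c)"
      proof (rule integral_bound)
        show "continuous_on {c..d} (\<lambda>y. \<phi> x - \<phi> y)"
          using K by (auto intro!: continuous_intros continuous_on_subset[OF cont])
        fix y assume "y \<in> {c..d}"
        then have "\<bar>\<phi> x - \<phi> y\<bar> < r" using K small by (intro \<delta>(2)) auto
        then show "norm (\<phi> x - \<phi> y) \<le> r" by simp
      qed (use K in auto)
      moreover have "integral {c..d} (\<lambda>y. \<phi> x - \<phi> y) = (d - c) * \<phi> x - integral {c..d} \<phi>"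
        using intK K by (subst integral_diff) auto
      ultimately show "\<bar>measure lborel K * \<phi> x - integral K \<phi>\<bar> \<le> measure lborel K * r"
        using K by (simp add: mult.commute)
    qed
    also have "\<dots> = (\<Sum>(x, K)\<in>p. measure lborel K) * r"
      by (simp add: sum_distrib_right case_prod_beta)
    also have "(\<Sum>(x, K)\<in>p. measure lborel K) = b - a"
      using additive_content_tagged_division[of p a b] p ab by simp
    also have "(b - a) * r < e" using r by (simp add: mult.commute)
    finally show "dist (\<Sum>(x, K)\<in>p. measure lborel K * \<phi> x) (integral {a..b} \<phi>) < e" .
  qed
qed

text \<open>Cousin's lemma for a constant gauge of radius \<open>\<delta> / 2\<close> gives a tagged
  division whose intervals are shorter than \<open>\<delta>\<close>. Properness of the filter is
  what makes Riemann integrals unique.\<close>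

lemma mesh_filter_neq_bot:
  "mesh_filter a b \<noteq> bot"
proof
  assume "mesh_filter a b = bot"
  then have "eventually (\<lambda>_. False) (mesh_filter a b)" by simp
  then obtain \<delta> where \<delta>: "\<delta> > 0"
    "\<And>p. p tagged_division_of {a..b} \<Longrightarrow> \<exists>(x, K)\<in>p. \<not> measure lborel K < \<delta>"
    unfolding eventually_mesh_filter by blast
  have "gauge (\<lambda>x::real. ball x (\<delta> / 2))" using \<delta>(1) by (intro gauge_ball_dependent) simp
  then obtain p where p: "p tagged_division_of {a..b}" "(\<lambda>x. ball x (\<delta> / 2)) fine p"
    using fine_division_exists_real by blast
  obtain x K where xK: "(x, K) \<in> p" "\<not> measure lborel K < \<delta>" using \<delta>(2)[OF p(1)] by blast
  obtain c d where K: "K = {c..d}" "c \<le> x" "x \<le> d" "measure lborel K = d - c"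
    using measure_lborel_tagged[OF p(1) xK(1)] by metis
  have "K \<subseteq> ball x (\<delta> / 2)" using p(2) xK(1) unfolding fine_def by blast
  moreover have "c \<in> K" "d \<in> K" using K by auto
  ultimately have "c \<in> ball x (\<delta> / 2)" "d \<in> ball x (\<delta> / 2)" by auto
  then show False using xK(2) K by (auto simp: dist_real_def)
qed

lemma sum_measure_tagged_subset_le:
  fixes a b :: real
  assumes p: "p tagged_division_of {a..b}" and sub: "p' \<subseteq> p"
    and in_I: "\<And>x K. (x, K) \<in> p' \<Longrightarrow> K \<subseteq> {c..d}" and cd: "c \<le> d"
  shows "(\<Sum>(x, K)\<in>p'. measure lborel K) \<le> d - c"
proof -
  have "p' tagged_partial_division_of {a..b}"
    using p sub by (meson tagged_division_of_def tagged_partial_division_subset)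
  then have td: "p' tagged_division_of (\<Union>(snd ` p'))"
    by (rule tagged_partial_division_of_Union_self)
  \<comment> \<open>Different tagged pairs can share an interval only if its interior is empty, and
    then its content is 0; so nothing is lost in passing to the set of intervals.\<close>
  have "(\<Sum>(x, K)\<in>p'. measure lborel K) = sum (measure lborel) (snd ` p')"
    using td by (rule sum.over_tagged_division_lemma) simp
  also have "\<dots> \<le> measure lborel (cbox c d)"
  proof (rule subadditive_content_division[OF division_of_tagged_division[OF td]])
    show "\<Union>(snd ` p') \<subseteq> cbox c d" using in_I by fastforce
  qed
  finally show ?thesis using cd by simp
qed

text \<open>Intervals of a division have disjoint interiors. With \<open>c\<close> an end of the
  supporting interval of a block, this says that at most one partition interval sticks out
  there.\<close>

lemma card_tagged_interior_le_1:
  fixes a b :: real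
  assumes p: "p tagged_division_of {a..b}" and sub: "p' \<subseteq> p"
    and int: "\<And>x K. (x, K) \<in> p' \<Longrightarrow> c \<in> interior K"
  shows "card p' \<le> 1"
proof -
  have "z = w" if "z \<in> p'" "w \<in> p'" for z w
  proof (rule ccontr)
    assume neq: "z \<noteq> w"
    obtain x K y L where zw: "z = (x, K)" "w = (y, L)" by fastforce
    have "interior K \<inter> interior L = {}"
      using tagged_division_ofD(5)[OF p, of x K y L] that sub neq zw by blast
    then show False using int that zw by blast
  qed
  moreover have "finite p'" using p sub by (meson finite_subset tagged_division_of_finite)
  ultimately show ?thesis by (metis card_le_Suc0_iff_eq One_nat_def)
qed

section \<open>Quasi-norms\<close>

text \<open>One admissible constant \<kappa> is fixed, because the scales of the construction are
  chosen in terms of it.\<close>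

locale quasi_norm_const =
  fixes q :: "'a::real_vector \<Rightarrow> real" and \<kappa> :: real
  assumes q_pos: "x \<noteq> 0 \<Longrightarrow> q x > 0"
    and q_scaleR: "q (a *\<^sub>R x) = \<bar>a\<bar> * q x"
    and \<kappa>_ge_1: "\<kappa> \<ge> 1"
    and q_triangle: "q (x + y) \<le> \<kappa> * (q x + q y)"
begin

lemma q_zero [simp]: "q 0 = 0"
  using q_scaleR[of 0 0] by simp

lemma q_nonneg [simp]: "q x \<ge> 0"
  using q_pos[of x] by (cases "x = 0") auto

lemma q_minus [simp]: "q (- x) = q x"
  using q_scaleR[of "-1" x] by simp

lemma q_minus_commute: "q (x - y) = q (y - x)"
  using q_minus[of "x - y"] by simp

lemma q_triangle_le: "q x \<le> A \<Longrightarrow> q y \<le> B \<Longrightarrow> q (x + y) \<le> \<kappa> * (A + B)"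
  using q_triangle[of x y] mult_left_mono[of "q x + q y" "A + B" \<kappa>] \<kappa>_ge_1 by linarith

lemma quasi_norm: "quasi_norm q"
  unfolding quasi_norm_def using q_pos q_scaleR \<kappa>_ge_1 q_triangle by blast

text \<open>Peeling off the first term costs one factor \<kappa> per step, which the decay
  \<open>\<kappa> * \<theta> \<le> 1 / 2\<close> pays for. Hence the bound does not grow with the
  number of terms.\<close>

lemma q_geometric_tail:
  assumes u: "\<And>k. k \<ge> K \<Longrightarrow> q (u k) \<le> C * \<theta> ^ k" and \<theta>: "0 \<le> \<theta>" "\<kappa> * \<theta> \<le> 1 / 2" and C: "C \<ge> 0"
  shows "q (\<Sum>k = K..<K + n. u k) \<le> 2 * \<kappa> * C * \<theta> ^ K"
  using u
proof (induction n arbitrary: K)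
  case 0
  then show ?case using \<kappa>_ge_1 \<theta> C by simp
next
  case (Suc n)
  have "(\<Sum>k = K..<K + Suc n. u k) = u K + (\<Sum>k = Suc K..<Suc K + n. u k)"
    by (simp add: sum.atLeast_Suc_lessThan)
  moreover have "q (\<Sum>k = Suc K..<Suc K + n. u k) \<le> 2 * \<kappa> * C * \<theta> ^ Suc K"
    using Suc.prems by (intro Suc.IH) simp
  ultimately have "q (\<Sum>k = K..<K + Suc n. u k) \<le> \<kappa> * (C * \<theta> ^ K + 2 * \<kappa> * C * \<theta> ^ Suc K)"
    using Suc.prems[of K] by (simp add: q_triangle_le del: power_Suc)
  also have "\<dots> = \<kappa> * C * \<theta> ^ K * (1 + 2 * (\<kappa> * \<theta>))" by (simp add: algebra_simps)
  also have "\<dots> \<le> \<kappa> * C * \<theta> ^ K * 2"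
    using \<theta> C \<kappa>_ge_1 by (intro mult_left_mono) auto
  finally show ?case by (simp add: mult.commute mult.left_commute)
qed

section \<open>Limits with respect to the quasi-norm\<close>

definition qlim :: "('b \<Rightarrow> 'a) \<Rightarrow> 'a \<Rightarrow> 'b filter \<Rightarrow> bool" where
  "qlim u l F \<longleftrightarrow> (\<forall>e>0. \<forall>\<^sub>F z in F. q (u z - l) < e)"

lemma limitin_iff_qlim: "limitin (quasi_norm_topology q) u l F \<longleftrightarrow> qlim u l F"
  unfolding qlim_def using quasi_norm by (rule limitin_quasi_norm_topology)

lemma qlim_add:
  assumes "qlim u l F" "qlim u' l' F"
  shows "qlim (\<lambda>z. u z + u' z) (l + l') F"
  unfolding qlim_def
proof (intro allI impI)
  fix e :: real assume e: "e > 0"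
  define d where "d = e / (2 * \<kappa>)"
  have d: "d > 0" "\<kappa> * (d + d) = e" using e \<kappa>_ge_1 by (auto simp: d_def)
  have "\<forall>\<^sub>F z in F. q (u z - l) < d" "\<forall>\<^sub>F z in F. q (u' z - l') < d"
    using assms d unfolding qlim_def by auto
  then show "\<forall>\<^sub>F z in F. q (u z + u' z - (l + l')) < e"
  proof eventually_elim
    case (elim z)
    have "q (u z + u' z - (l + l')) \<le> \<kappa> * (q (u z - l) + q (u' z - l'))"
      using q_triangle[of "u z - l" "u' z - l'"] by (simp add: algebra_simps)
    also have "\<dots> < \<kappa> * (d + d)" using elim \<kappa>_ge_1 by (intro mult_strict_left_mono) auto
    finally show ?case using d by simp
  qed
qed

lemma qlim_sum:
  assumes "finite A" "\<And>i. i \<in> A \<Longrightarrow> qlim (u i) (l i) F"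
  shows "qlim (\<lambda>z. \<Sum>i\<in>A. u i z) (\<Sum>i\<in>A. l i) F"
  using assms proof (induction A)
  case (insert i A)
  then have "qlim (u i) (l i) F" "qlim (\<lambda>z. \<Sum>i\<in>A. u i z) (\<Sum>i\<in>A. l i) F" by auto
  from qlim_add[OF this] show ?case using insert.hyps by simp
qed (simp add: qlim_def)

lemma qlim_scaleR:
  fixes \<phi> :: "'b \<Rightarrow> real"
  assumes "(\<phi> \<longlongrightarrow> c) F"
  shows "qlim (\<lambda>z. \<phi> z *\<^sub>R x) (c *\<^sub>R x) F"
  unfolding qlim_def
proof (intro allI impI)
  fix e :: real assume e: "e > 0"
  have "((\<lambda>z. \<bar>\<phi> z - c\<bar> * q x) \<longlongrightarrow> \<bar>c - c\<bar> * q x) F"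
    using assms by (intro tendsto_intros)
  then have "\<forall>\<^sub>F z in F. \<bar>\<phi> z - c\<bar> * q x < e" using e by (intro order_tendstoD) auto
  then show "\<forall>\<^sub>F z in F. q (\<phi> z *\<^sub>R x - c *\<^sub>R x) < e"
    by (simp add: q_scaleR flip: scaleR_left_diff_distrib)
qed

lemma qlim_unique:
  assumes "qlim u l F" "qlim u l' F" "F \<noteq> bot"
  shows "l = l'"
proof (rule ccontr)
  assume "l \<noteq> l'"
  then have e: "q (l' - l) > 0" by (simp add: q_pos)
  \<comment> \<open>The sum of \<open>u\<close> and \<open>- u\<close> is constantly 0, yet it
    converges to \<open>l - l'\<close>.\<close>
  have "qlim (\<lambda>z. (-1) *\<^sub>R u z) ((-1) *\<^sub>R l') F"
    using assms(2) unfolding qlim_def by (simp add: q_minus_commute)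
  from qlim_add[OF assms(1) this] have "\<forall>d>0. \<forall>\<^sub>F z in F. q (l' - l) < d"
    unfolding qlim_def by simp
  with e have "\<forall>\<^sub>F z in F. q (l' - l) < q (l' - l)" by blast
  then show False using assms(3) by simp
qed

text \<open>Dominated convergence for series: the tails are uniformly small by
  \<open>q_geometric_tail\<close>, and the finite head converges termwise. For each \<open>z\<close>
  the sum is finite, with a length that may depend on \<open>z\<close>. The lemma serves both for
  the continuity of \<open>f\<close> and for its integration term by term.\<close>

lemma qlim_dominated_sum:
  fixes u :: "nat \<Rightarrow> 'b \<Rightarrow> 'a"
  assumes lim: "\<And>k. qlim (u k) (l k) F"
    and bound: "\<forall>\<^sub>F z in F. \<forall>k. q (u k z) \<le> C * \<theta> ^ k" "\<And>k. q (l k) \<le> C * \<theta> ^ k"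
    and \<theta>: "0 \<le> \<theta>" "\<kappa> * \<theta> \<le> 1 / 2" and C: "C \<ge> 0"
    and fin: "\<forall>\<^sub>F z in F. \<exists>N. \<forall>n\<ge>N. U z = (\<Sum>k<n. u k z)" "\<exists>N. \<forall>n\<ge>N. L = (\<Sum>k<n. l k)"
  shows "qlim U L F"
  unfolding qlim_def
proof (intro allI impI)
  fix e :: real assume e: "e > 0"
  define D where "D = 2 * \<kappa> * C"
  have "D \<ge> 0" using \<kappa>_ge_1 C by (simp add: D_def)
  have "\<theta> \<le> \<kappa> * \<theta>" using \<kappa>_ge_1 \<theta> mult_right_mono[of 1 \<kappa> \<theta>] by simp
  then have "(\<lambda>K. \<kappa> * (\<kappa> * (D * \<theta> ^ K + D * \<theta> ^ K))) \<longlonglongrightarrow> \<kappa> * (\<kappa> * (D * 0 + D * 0))"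
    using \<theta> by (intro tendsto_intros LIMSEQ_power_zero) auto
  then have "\<forall>\<^sub>F K in sequentially. \<kappa> * (\<kappa> * (D * \<theta> ^ K + D * \<theta> ^ K)) < e / 2"
    using e by (intro order_tendstoD(2)) auto
  \<comment> \<open>The two tails pass through the quasi-triangle inequality twice, once together
    and once with the head; this leaves \<open>e / 2\<close> for the head, which must then be below
    \<open>e / (2 * \<kappa>)\<close>.\<close>
  then obtain K where K: "\<kappa> * (\<kappa> * (D * \<theta> ^ K + D * \<theta> ^ K)) < e / 2"
    by (auto simp: eventually_sequentially)
  have tail: "q (x - (\<Sum>k<K. v k)) \<le> D * \<theta> ^ K"
    if v: "\<And>k. q (v k) \<le> C * \<theta> ^ k" and N: "\<exists>N. \<forall>n\<ge>N. x = (\<Sum>k<n. v k)" for v x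
  proof -
    obtain N where "\<forall>n\<ge>N. x = (\<Sum>k<n. v k)" using N by blast
    \<comment> \<open>The index \<open>K + N\<close> is beyond \<open>N\<close> and also beyond
      \<open>K\<close>, so the head can be split off.\<close>
    then have "x = (\<Sum>k<K + N. v k)" by simp
    also have "{..<K + N} = {..<K} \<union> {K..<K + N}" by auto
    also have "sum v \<dots> = sum v {..<K} + sum v {K..<K + N}" by (rule sum.union_disjoint) auto
    finally show ?thesis
      unfolding D_def using q_geometric_tail[of K v C \<theta> N] v \<theta> C by simp
  qed
  have "qlim (\<lambda>z. \<Sum>k<K. u k z) (\<Sum>k<K. l k) F" using lim by (intro qlim_sum) auto
  moreover have "e / (2 * \<kappa>) > 0" using e \<kappa>_ge_1 by simp
  ultimately have "\<forall>\<^sub>F z in F. q ((\<Sum>k<K. u k z) - (\<Sum>k<K. l k)) < e / (2 * \<kappa>)"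
    unfolding qlim_def by blast
  then show "\<forall>\<^sub>F z in F. q (U z - L) < e"
    using bound(1) fin(1)
  proof eventually_elim
    case (elim z)
    let ?u = "\<Sum>k<K. u k z" and ?l = "\<Sum>k<K. l k"
    have "q ((U z - ?u) - (L - ?l)) \<le> \<kappa> * (D * \<theta> ^ K + D * \<theta> ^ K)"
      unfolding diff_conv_add_uminus[of "U z - ?u"]
      using tail[of "\<lambda>k. u k z" "U z"] tail[of l L] elim bound(2) fin(2)
      by (intro q_triangle_le) (simp_all only: q_minus)
    from q_triangle_le[OF less_imp_le[OF elim(1)] this]
    have "q (U z - L) \<le> \<kappa> * (e / (2 * \<kappa>) + \<kappa> * (D * \<theta> ^ K + D * \<theta> ^ K))"
      by (simp add: algebra_simps)
    also have "\<dots> = e / 2 + \<kappa> * (\<kappa> * (D * \<theta> ^ K + D * \<theta> ^ K))"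
      using \<kappa>_ge_1 by (simp add: algebra_simps)
    finally show ?case using K by linarith
  qed
qed

lemma riemann_integral_eqI:
  assumes "has_riemann_integral (quasi_norm_topology q) f l a b"
  shows "riemann_integral (quasi_norm_topology q) f a b = l"
  unfolding riemann_integral_def
proof (rule the_equality)
  show "l' = l" if "has_riemann_integral (quasi_norm_topology q) f l' a b" for l'
    using assms that qlim_unique mesh_filter_neq_bot
    unfolding has_riemann_integral_def limitin_iff_qlim by metis
qed (rule assms)

section \<open>Failure of local convexity\<close>

text \<open>If convex hulls of small balls are small, their translates serve as convex
  neighbourhoods of arbitrary points.\<close>

lemma locally_convexI:
  assumes "\<And>e. e > 0 \<Longrightarrow> \<exists>r>0. convex hull {x. q x < r} \<subseteq> {x. q x < e}"
  shows "locally_convex (quasi_norm_topology q)"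
  unfolding locally_convex_def neighbourhood_base_of openin_quasi_norm_topology
proof (intro allI impI)
  fix W x assume "(\<forall>x\<in>W. \<exists>e>0. \<forall>y. q (y - x) < e \<longrightarrow> y \<in> W) \<and> x \<in> W"
  then obtain e where e: "e > 0" "\<And>y. q (y - x) < e \<Longrightarrow> y \<in> W" by blast
  obtain r where r: "r > 0" "convex hull {x. q x < r} \<subseteq> {x. q x < e}" using assms e(1) by blast
  define V where "V = (+) x ` (convex hull {x. q x < r})"
  \<comment> \<open>The interior of \<open>V\<close>: an open set between \<open>x\<close> and the
    convex \<open>V\<close> is required, and balls need not be open. Its openness comes from halving
    radii up to the factor \<kappa>.\<close>
  define U where "U = {y. \<exists>d>0. \<forall>z. q (z - y) < d \<longrightarrow> z \<in> V}"
  have "\<exists>d>0. \<forall>w. q (w - y) < d \<longrightarrow> w \<in> U" if y: "y \<in> U" for y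
  proof -
    obtain d where d: "d > 0" "\<And>z. q (z - y) < d \<Longrightarrow> z \<in> V"
      using y unfolding U_def by blast
    define d' where "d' = d / (2 * \<kappa>)"
    have d': "d' > 0" "\<kappa> * (d' + d') = d" using d \<kappa>_ge_1 by (auto simp: d'_def)
    have "q (z - y) < d" if "q (w - y) < d'" "q (z - w) < d'" for w z
    proof -
      have "q (z - y) \<le> \<kappa> * (q (z - w) + q (w - y))" using q_triangle[of "z - w" "w - y"] by simp
      also have "\<dots> < \<kappa> * (d' + d')" using that \<kappa>_ge_1 by (intro mult_strict_left_mono) auto
      finally show ?thesis using d' by simp
    qed
    then show ?thesis unfolding U_def using d d' by blast
  qed
  moreover have "convex V" unfolding V_def by (simp add: convex_translation)
  moreover have "x \<in> U"
  proof -
    have "z \<in> V" if "q (z - x) < r" for z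
      unfolding V_def using that by (intro image_eqI[of _ _ "z - x"] hull_inc) auto
    then show ?thesis unfolding U_def using r(1) by blast
  qed
  moreover have "U \<subseteq> V" unfolding U_def by force
  moreover have "V \<subseteq> W" unfolding V_def using r(2) e(2) by auto
  ultimately show "\<exists>U V. (\<forall>x\<in>U. \<exists>e>0. \<forall>y. q (y - x) < e \<longrightarrow> y \<in> U) \<and> convex V \<and> x \<in> U \<and> U \<subseteq> V \<and> V \<subseteq> W"
    by blast
qed

text \<open>By \<open>locally_convexI\<close> there is one \<open>e\<close> such that the hull of
  every ball contains a vector of quasi-norm at least \<open>e\<close>. Scaling by
  \<open>N / e\<close> turns this into size \<open>N\<close>, starting from a ball shrunk by the
  same factor.\<close>

lemma convex_hull_small_ball_unbounded:
  assumes "\<not> locally_convex (quasi_norm_topology q)" and \<epsilon>: "\<epsilon> > 0" and N: "N > 0"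
  obtains y where "y \<in> convex hull {x. q x \<le> \<epsilon>}" "q y \<ge> N"
proof -
  obtain e where e: "e > 0" "\<And>r. r > 0 \<Longrightarrow> \<not> convex hull {x. q x < r} \<subseteq> {x. q x < e}"
    using locally_convexI assms(1) by blast
  define c where "c = N / e"
  have c: "c > 0" using N e by (simp add: c_def)
  obtain y where y: "y \<in> convex hull {x. q x < \<epsilon> / c}" "q y \<ge> e"
    using e(2)[of "\<epsilon> / c"] \<epsilon> c by (auto simp: not_less[symmetric])
  have "c *\<^sub>R y \<in> convex hull ((*\<^sub>R) c ` {x. q x < \<epsilon> / c})"
    unfolding convex_hull_scaling using y(1) by (rule imageI)
  moreover have "(*\<^sub>R) c ` {x. q x < \<epsilon> / c} \<subseteq> {x. q x \<le> \<epsilon>}"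
    using c by (auto simp: q_scaleR field_simps)
  ultimately have "c *\<^sub>R y \<in> convex hull {x. q x \<le> \<epsilon>}" using hull_mono by blast
  moreover have "q (c *\<^sub>R y) \<ge> N"
    using N y(2) e(1) mult_left_mono[of e "q y" c] by (simp add: q_scaleR c_def)
  ultimately show ?thesis by (rule that)
qed

text \<open>The bound may depend on \<open>S\<close>, so the loss of a factor \<kappa> per vector
  does no harm. It makes the supremum in \<open>nearly_extremal_combination\<close> finite.\<close>

lemma q_sum_bounded:
  assumes "finite S"
  shows "\<exists>B. \<forall>s. (\<Sum>v\<in>S. \<bar>s v\<bar>) \<le> 1 \<longrightarrow> q (\<Sum>v\<in>S. s v *\<^sub>R v) \<le> B"
  using assms
proof (induction S)
  case empty
  show ?case by auto
next
  case (insert x S)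
  then obtain B where B: "\<And>s. (\<Sum>v\<in>S. \<bar>s v\<bar>) \<le> 1 \<Longrightarrow> q (\<Sum>v\<in>S. s v *\<^sub>R v) \<le> B" by blast
  have "q (\<Sum>v\<in>insert x S. s v *\<^sub>R v) \<le> \<kappa> * (q x + B)" if s: "(\<Sum>v\<in>insert x S. \<bar>s v\<bar>) \<le> 1" for s
  proof -
    have "\<bar>s x\<bar> + (\<Sum>v\<in>S. \<bar>s v\<bar>) \<le> 1" using s insert.hyps by simp
    moreover have "(\<Sum>v\<in>S. \<bar>s v\<bar>) \<ge> 0" by (simp add: sum_nonneg)
    ultimately have "\<bar>s x\<bar> \<le> 1" "(\<Sum>v\<in>S. \<bar>s v\<bar>) \<le> 1" by linarith+
    then have "q (s x *\<^sub>R x) \<le> q x" "q (\<Sum>v\<in>S. s v *\<^sub>R v) \<le> B"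
      using B mult_right_mono[of "\<bar>s x\<bar>" 1 "q x"] by (auto simp: q_scaleR)
    then show ?thesis using insert.hyps by (simp add: q_triangle_le)
  qed
  then show ?case by blast
qed

text \<open>Among the absolutely convex combinations of a finite set of small vectors, one is taken
  whose quasi-norm exceeds half the supremum. It will give the integral of a block up to its centre,
  while the Riemann sums inside the block are multiples of other such combinations and thus under
  control.\<close>

lemma nearly_extremal_combination:
  assumes nlc: "\<not> locally_convex (quasi_norm_topology q)" and \<epsilon>: "\<epsilon> > 0" and N: "N > 0"
  obtains S s where "finite S" "\<And>v. v \<in> S \<Longrightarrow> q v \<le> \<epsilon>" "(\<Sum>v\<in>S. \<bar>s v\<bar>) \<le> 1"
    "q (\<Sum>v\<in>S. s v *\<^sub>R v) \<ge> N"
    "\<And>s'. (\<Sum>v\<in>S. \<bar>s' v\<bar>) \<le> 1 \<Longrightarrow> q (\<Sum>v\<in>S. s' v *\<^sub>R v) \<le> 2 * q (\<Sum>v\<in>S. s v *\<^sub>R v)"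
proof -
  \<comment> \<open>Size \<open>2 * N\<close> is requested because half of the supremum is given
    away.\<close>
  obtain y where y: "y \<in> convex hull {x. q x \<le> \<epsilon>}" "q y \<ge> 2 * N"
    using convex_hull_small_ball_unbounded[OF nlc \<epsilon>, of "2 * N"] N by auto
  then obtain S u where S: "finite S" "S \<subseteq> {x. q x \<le> \<epsilon>}" "\<forall>x\<in>S. 0 \<le> u x" "sum u S = 1"
    "(\<Sum>v\<in>S. u v *\<^sub>R v) = y"
    unfolding convex_hull_explicit by blast
  define Q where "Q = (\<lambda>s. q (\<Sum>v\<in>S. s v *\<^sub>R v)) ` {s. (\<Sum>v\<in>S. \<bar>s v\<bar>) \<le> 1}"
  have bdd: "bdd_above Q"
    using q_sum_bounded[OF S(1)] unfolding Q_def bdd_above_def by blast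
  have "(\<Sum>v\<in>S. \<bar>u v\<bar>) = 1" using S by simp
  then have "q y \<in> Q" unfolding Q_def using S(5) by (intro image_eqI[of _ _ u]) auto
  then have Sup: "2 * N \<le> Sup Q" using y(2) bdd cSup_upper by fastforce
  then have "Sup Q / 2 < Sup Q" using N by simp
  then obtain z where "z \<in> Q" "Sup Q / 2 < z" using \<open>q y \<in> Q\<close> bdd less_cSup_iff by blast
  then obtain s where s: "(\<Sum>v\<in>S. \<bar>s v\<bar>) \<le> 1" "Sup Q / 2 < q (\<Sum>v\<in>S. s v *\<^sub>R v)"
    unfolding Q_def by blast
  have "q (\<Sum>v\<in>S. s' v *\<^sub>R v) \<le> Sup Q" if "(\<Sum>v\<in>S. \<bar>s' v\<bar>) \<le> 1" for s'
    using that bdd unfolding Q_def by (intro cSup_upper) auto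
  then show ?thesis using S s Sup by (intro that[of S s]) force+
qed

section \<open>Blocks\<close>

text \<open>A block is \<open>t \<mapsto> \<Sum>v\<in>S. \<phi> v t *\<^sub>R v\<close>, and \<open>X v\<close> is a primitive of \<open>\<phi> v\<close>.\<close>

definition block ::
  "real \<Rightarrow> real \<Rightarrow> real \<Rightarrow> real \<Rightarrow> 'a set \<Rightarrow> ('a \<Rightarrow> real \<Rightarrow> real) \<Rightarrow> ('a \<Rightarrow> real \<Rightarrow> real) \<Rightarrow> bool"
where
  "block c m \<epsilon> L S \<phi> X \<longleftrightarrow> finite S \<and> 0 < L \<and> L \<le> m / 2 \<and>
     (\<forall>v\<in>S. q v \<le> \<epsilon>) \<and>
     (\<forall>v\<in>S. continuous_on UNIV (\<phi> v)) \<and>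
     (\<forall>v\<in>S. \<forall>t. (X v has_real_derivative \<phi> v t) (at t)) \<and>
     (\<forall>v\<in>S. \<forall>t. \<bar>\<phi> v t\<bar> \<le> 1) \<and>
     (\<forall>v\<in>S. \<forall>t. t \<le> m - L \<or> t \<ge> m + L \<longrightarrow> \<phi> v t = 0 \<and> X v t = 0) \<and>
     (\<forall>t. \<exists>u. \<forall>v\<in>S - {u}. \<phi> v t = 0) \<and>
     q (\<Sum>v\<in>S. X v m *\<^sub>R v) = c \<and>
     (\<forall>s. (\<Sum>v\<in>S. \<bar>s v\<bar>) \<le> 1 \<longrightarrow> L * q (\<Sum>v\<in>S. s v *\<^sub>R v) \<le> 4 * c)"

text \<open>The bumps of a nearly extremal combination fit into \<open>[0, 1]\<close>. A rescaled
  copy is run through on the left of \<open>m\<close> and its negative on the right, so the integral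
  up to \<open>m\<close> is \<open>(L / 2) *\<^sub>R y\<close> and the total integral is 0.\<close>

lemma block_exists:
  assumes nlc: "\<not> locally_convex (quasi_norm_topology q)" and \<epsilon>: "\<epsilon> > 0" and c: "c > 0" and m: "m > 0"
  shows "\<exists>L S \<phi> X. block c m \<epsilon> L S \<phi> X"
proof -
  \<comment> \<open>This size of the combination ensures \<open>L \<le> m / 2\<close> below.\<close>
  have N: "4 * c / m > 0" using c m by simp
  obtain S s where S: "finite S" "\<And>v. v \<in> S \<Longrightarrow> q v \<le> \<epsilon>" "(\<Sum>v\<in>S. \<bar>s v\<bar>) \<le> 1"
    "q (\<Sum>v\<in>S. s v *\<^sub>R v) \<ge> 4 * c / m"
    "\<And>s'. (\<Sum>v\<in>S. \<bar>s' v\<bar>) \<le> 1 \<Longrightarrow> q (\<Sum>v\<in>S. s' v *\<^sub>R v) \<le> 2 * q (\<Sum>v\<in>S. s v *\<^sub>R v)"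
    by (rule nearly_extremal_combination[OF nlc \<epsilon> N]) blast
  obtain \<Psi> \<psi> where "disjoint_bumps S s \<Psi> \<psi>" using disjoint_bumps_exist[OF S(1)] by blast
  then have \<psi>:
    "\<And>v t. v \<in> S \<Longrightarrow> (\<Psi> v has_real_derivative \<psi> v t) (at t)"
    "\<And>v. v \<in> S \<Longrightarrow> continuous_on UNIV (\<psi> v)"
    "\<And>v t. v \<in> S \<Longrightarrow> \<bar>\<psi> v t\<bar> \<le> 1"
    "\<And>v t. v \<in> S \<Longrightarrow> t \<le> 0 \<Longrightarrow> \<psi> v t = 0 \<and> \<Psi> v t = 0"
    "\<And>v t. v \<in> S \<Longrightarrow> t \<ge> (\<Sum>v\<in>S. \<bar>s v\<bar>) \<Longrightarrow> \<psi> v t = 0 \<and> \<Psi> v t = s v / 2"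
    "\<And>t. \<exists>u. \<forall>v\<in>S - {u}. \<psi> v t = 0"
    unfolding disjoint_bumps_def by blast+
  have \<psi>1: "\<psi> v t = 0 \<and> \<Psi> v t = s v / 2" if "v \<in> S" "t \<ge> 1" for v t
    using \<psi>(5)[OF that(1), of t] that(2) S(3) by linarith
  define y where "y = (\<Sum>v\<in>S. s v *\<^sub>R v)"
  \<comment> \<open>Chosen so that \<open>(L / 2) *\<^sub>R y\<close> has quasi-norm exactly
    \<open>c\<close>; near extremality then bounds \<open>L\<close> times any competing combination
    by \<open>L * (2 * q y) = 4 * c\<close>.\<close>
  define L where "L = 2 * c / q y"
  have qy: "q y > 0" "q y \<ge> 4 * c / m" using S(4) N unfolding y_def by linarith+
  have L: "L > 0" "L \<le> m / 2" "L * q y = 2 * c"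
    using qy c m by (auto simp: L_def field_simps)
  define w where "w t = (t - m) / L" for t
  have w: "(w has_real_derivative 1 / L) (at t)" for t
    unfolding w_def [abs_def] using L by (auto intro!: derivative_eq_intros)
  define \<phi> where "\<phi> v t = \<psi> v (w t + 1) - \<psi> v (w t)" for v t
  define X where "X v t = L * (\<Psi> v (w t + 1) - \<Psi> v (w t))" for v t
  have "block c m \<epsilon> L S \<phi> X"
    unfolding block_def
  proof (intro conjI ballI allI impI)
    fix v t assume v: "v \<in> S"
    show "continuous_on UNIV (\<phi> v)"
      unfolding \<phi>_def [abs_def] w_def using L
      by (intro continuous_intros continuous_on_compose2[OF \<psi>(2)[OF v]]) auto
    have "((\<lambda>t. \<Psi> v (w t + 1)) has_real_derivative \<psi> v (w t + 1) * (1 / L)) (at t)"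
      by (rule DERIV_chain2[OF \<psi>(1)[OF v]]) (auto intro!: derivative_eq_intros w)
    moreover have "((\<lambda>t. \<Psi> v (w t)) has_real_derivative \<psi> v (w t) * (1 / L)) (at t)"
      by (rule DERIV_chain2[OF \<psi>(1)[OF v] w])
    ultimately have "(X v has_real_derivative L * (\<psi> v (w t + 1) * (1 / L) - \<psi> v (w t) * (1 / L))) (at t)"
      unfolding X_def [abs_def] by (intro DERIV_cmult DERIV_diff)
    then show "(X v has_real_derivative \<phi> v t) (at t)"
      using L by (simp add: \<phi>_def algebra_simps)
    \<comment> \<open>The two copies live on \<open>[m - L, m]\<close> and
      \<open>[m, m + L]\<close>, so they never overlap.\<close>
    have "\<psi> v (w t + 1) = 0 \<or> \<psi> v (w t) = 0"
      using \<psi>(4)[OF v, of "w t"] \<psi>1[OF v, of "w t + 1"] by linarith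
    then show "\<bar>\<phi> v t\<bar> \<le> 1"
      using \<psi>(3)[OF v] by (auto simp: \<phi>_def)
    assume "t \<le> m - L \<or> t \<ge> m + L"
    then have "w t + 1 \<le> 0 \<or> w t \<ge> 1" using L by (auto simp: w_def field_simps)
    then have "\<psi> v (w t + 1) = \<psi> v (w t) \<and> \<Psi> v (w t + 1) = \<Psi> v (w t)"
      using \<psi>(4)[OF v, of "w t"] \<psi>(4)[OF v, of "w t + 1"] \<psi>1[OF v, of "w t"] \<psi>1[OF v, of "w t + 1"]
      by auto
    then show "\<phi> v t = 0" "X v t = 0" by (simp_all add: \<phi>_def X_def)
  next
    fix t
    obtain u u' where u: "\<forall>v\<in>S - {u}. \<psi> v (w t + 1) = 0" "\<forall>v\<in>S - {u'}. \<psi> v (w t) = 0"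
      using \<psi>(6) by metis
    show "\<exists>u. \<forall>v\<in>S - {u}. \<phi> v t = 0"
    proof (cases "w t \<le> 0")
      case True
      then show ?thesis using u(1) \<psi>(4) by (intro exI[of _ u]) (auto simp: \<phi>_def)
    next
      case False
      then show ?thesis using u(2) \<psi>1 by (intro exI[of _ u']) (auto simp: \<phi>_def)
    qed
  next
    have "X v m = L / 2 * s v" if "v \<in> S" for v
      using \<psi>(4)[OF that, of 0] \<psi>1[OF that, of 1] by (simp add: X_def w_def)
    then have "(\<Sum>v\<in>S. X v m *\<^sub>R v) = (L / 2) *\<^sub>R y"
      unfolding y_def scaleR_sum_right by (intro sum.cong) auto
    then show "q (\<Sum>v\<in>S. X v m *\<^sub>R v) = c" using L by (simp add: q_scaleR)
  next
    fix s' :: "'a \<Rightarrow> real" assume "(\<Sum>v\<in>S. \<bar>s' v\<bar>) \<le> 1"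
    then have "q (\<Sum>v\<in>S. s' v *\<^sub>R v) \<le> 2 * q y" using S(5) unfolding y_def by blast
    then have "L * q (\<Sum>v\<in>S. s' v *\<^sub>R v) \<le> L * (2 * q y)" using L by (intro mult_left_mono) auto
    then show "L * q (\<Sum>v\<in>S. s' v *\<^sub>R v) \<le> 4 * c" using L(3) by linarith
  qed (use S L in auto)
  then show ?thesis by blast
qed

section \<open>Values and Riemann sums of a single block\<close>

context
  fixes c m \<epsilon> L S \<phi> X g
  assumes block: "block c m \<epsilon> L S \<phi> X" and c_pos: "c > 0" and \<epsilon>_pos: "\<epsilon> > 0"
    and g: "\<And>t. g t = (\<Sum>v\<in>S. \<phi> v t *\<^sub>R v)"
begin

lemma block_outside: "t \<le> m - L \<or> t \<ge> m + L \<Longrightarrow> g t = 0"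
  using block unfolding block_def g by (intro sum.neutral) auto

text \<open>At each \<open>t\<close> at most one coefficient is nonzero, so \<open>g t\<close> is a
  multiple of a single small vector and no factor \<kappa> is lost, however large \<open>S\<close>
  is.\<close>

lemma block_sum_le: "(\<Sum>v\<in>S. \<bar>\<phi> v t\<bar>) \<le> 1"
  and block_le: "q (g t) \<le> \<epsilon>"
proof -
  obtain u where u: "\<forall>v\<in>S - {u}. \<phi> v t = 0" using block unfolding block_def by blast
  have S: "finite S" "\<And>v. v \<in> S \<Longrightarrow> \<bar>\<phi> v t\<bar> \<le> 1" "\<And>v. v \<in> S \<Longrightarrow> q v \<le> \<epsilon>"
    using block unfolding block_def by auto
  have "(\<Sum>v\<in>S. \<bar>\<phi> v t\<bar>) \<le> 1 \<and> q (g t) \<le> \<epsilon>"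
  proof (cases "u \<in> S")
    case True
    have "(\<Sum>v\<in>S. \<bar>\<phi> v t\<bar>) = \<bar>\<phi> u t\<bar>" "g t = \<phi> u t *\<^sub>R u"
      unfolding g using True u S(1) by (auto simp: sum.remove)
    then show ?thesis
      using S(2,3)[OF True] mult_mono[of "\<bar>\<phi> u t\<bar>" 1 "q u" \<epsilon>] by (auto simp: q_scaleR)
  next
    case False
    then have "\<forall>v\<in>S. \<phi> v t = 0" using u by blast
    then show ?thesis unfolding g using \<epsilon>_pos by simp
  qed
  then show "(\<Sum>v\<in>S. \<bar>\<phi> v t\<bar>) \<le> 1" "q (g t) \<le> \<epsilon>" by auto
qed

lemma block_qlim: "qlim g (g x) (at x within A)"
proof -
  have "qlim (\<lambda>t. \<Sum>v\<in>S. \<phi> v t *\<^sub>R v) (\<Sum>v\<in>S. \<phi> v x *\<^sub>R v) (at x within A)"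
  proof (intro qlim_sum qlim_scaleR)
    fix v assume "v \<in> S"
    then have "continuous_on UNIV (\<phi> v)" using block unfolding block_def by blast
    then show "(\<phi> v \<longlongrightarrow> \<phi> v x) (at x within A)"
      using continuous_on_tendsto_compose[OF _ tendsto_ident_at] by fastforce
  qed (use block in \<open>auto simp: block_def\<close>)
  then show ?thesis by (simp add: g [abs_def])
qed

text \<open>Interchanging the finite sums reduces the claim to the scalar Riemann sums of each
  \<open>\<phi> v\<close>, whose integral is read off from the primitive \<open>X v\<close>.\<close>

lemma block_riemann_sums:
  assumes "a \<le> b"
  shows "qlim (\<lambda>p. \<Sum>(x, K)\<in>p. measure lborel K *\<^sub>R g x) (\<Sum>v\<in>S. (X v b - X v a) *\<^sub>R v)
    (mesh_filter a b)"
proof -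
  let ?I = "\<Sum>v\<in>S. (X v b - X v a) *\<^sub>R v"
  have lim: "qlim (\<lambda>p. \<Sum>v\<in>S. (\<Sum>(x, K)\<in>p. measure lborel K * \<phi> v x) *\<^sub>R v)
      ?I (mesh_filter a b)"
  proof (intro qlim_sum qlim_scaleR)
    fix v assume "v \<in> S"
    then have cont: "continuous_on UNIV (\<phi> v)"
      and deriv: "\<And>t. (X v has_real_derivative \<phi> v t) (at t)"
      using block unfolding block_def by auto
    have "(\<phi> v has_integral (X v b - X v a)) {a..b}"
      using deriv assms by (intro fundamental_theorem_of_calculus)
        (auto simp flip: has_real_derivative_iff_has_vector_derivative intro: DERIV_subset)
    then have "integral {a..b} (\<phi> v) = X v b - X v a" by (rule integral_unique)
    then show "((\<lambda>p. \<Sum>(x, K)\<in>p. measure lborel K * \<phi> v x) \<longlongrightarrow> X v b - X v a) (mesh_filter a b)"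
      using riemann_sums_tendsto_integral[of a b "\<phi> v"] assms continuous_on_subset[OF cont] by simp
  qed (use block in \<open>auto simp: block_def\<close>)
  have swap: "(\<lambda>p. \<Sum>v\<in>S. (\<Sum>(x, K)\<in>p. measure lborel K * \<phi> v x) *\<^sub>R v)
      = (\<lambda>p. \<Sum>(x, K)\<in>p. measure lborel K *\<^sub>R g x)"
    unfolding g scaleR_sum_left scaleR_sum_right case_prod_beta
    by (rule ext, subst sum.swap) simp
  show ?thesis
    by (rule back_subst[where P = "\<lambda>u. qlim u ?I (mesh_filter a b)", OF lim swap])
qed

lemma block_protruding_term:
  assumes p: "p tagged_division_of {a..b}" "\<forall>(x, K)\<in>p. measure lborel K < 1" and sub: "p' \<subseteq> p"
    and int: "\<And>x K. (x, K) \<in> p' \<Longrightarrow> z \<in> interior K"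
  shows "q (\<Sum>(x, K)\<in>p'. measure lborel K *\<^sub>R g x) \<le> \<epsilon>"
proof -
  have fin: "finite p'" using p sub by (meson finite_subset tagged_division_of_finite)
  have "card p' \<le> 1" using card_tagged_interior_le_1[OF p(1) sub] int by blast
  then have "card p' = 0 \<or> card p' = 1" by linarith
  then show ?thesis
  proof
    assume "card p' = 0"
    then show ?thesis using fin \<epsilon>_pos by simp
  next
    assume "card p' = 1"
    then obtain x K where p': "p' = {(x, K)}" by (metis card_1_singletonE old.prod.exhaust)
    then have "measure lborel K \<le> 1" using p(2) sub by auto
    then have "measure lborel K * q (g x) \<le> 1 * \<epsilon>"
      by (intro mult_mono block_le) auto
    then show ?thesis using p' by (simp add: q_scaleR)
  qed
qed

text \<open>The intervals have total length at most \<open>2 * L\<close> and the coefficients at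
  each tag have absolute sum at most 1. Divided by \<open>2 * L\<close>, the sum is therefore an
  absolutely convex combination of \<open>S\<close>, and the last clause of \<open>block\<close>
  gives \<open>2 * (4 * c)\<close>.\<close>

lemma block_inner_terms:
  assumes p: "p tagged_division_of {a..b}" and sub: "p' \<subseteq> p"
    and int: "\<And>x K. (x, K) \<in> p' \<Longrightarrow> K \<subseteq> {m - L..m + L}"
  shows "q (\<Sum>(x, K)\<in>p'. measure lborel K *\<^sub>R g x) \<le> 8 * c"
proof -
  have L: "L > 0" using block unfolding block_def by blast
  define s where "s v = (\<Sum>(x, K)\<in>p'. measure lborel K * \<phi> v x) / (2 * L)" for v
  have "(\<Sum>v\<in>S. \<bar>s v\<bar>) \<le> (\<Sum>v\<in>S. (\<Sum>(x, K)\<in>p'. measure lborel K * \<bar>\<phi> v x\<bar>) / (2 * L))"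
  proof (intro sum_mono)
    fix v
    have "\<bar>\<Sum>(x, K)\<in>p'. measure lborel K * \<phi> v x\<bar> \<le> (\<Sum>(x, K)\<in>p'. measure lborel K * \<bar>\<phi> v x\<bar>)"
      using sum_abs[of "\<lambda>(x, K). measure lborel K * \<phi> v x" p'] by (simp add: case_prod_beta abs_mult)
    then show "\<bar>s v\<bar> \<le> (\<Sum>(x, K)\<in>p'. measure lborel K * \<bar>\<phi> v x\<bar>) / (2 * L)"
      using L by (simp add: s_def divide_right_mono)
  qed
  also have "\<dots> = (\<Sum>(x, K)\<in>p'. measure lborel K * (\<Sum>v\<in>S. \<bar>\<phi> v x\<bar>)) / (2 * L)"
    unfolding sum_divide_distrib[symmetric] sum_distrib_left case_prod_beta
    by (subst sum.swap) simp
  also have "\<dots> \<le> (\<Sum>(x, K)\<in>p'. measure lborel K * 1) / (2 * L)"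
    using L block_sum_le by (intro divide_right_mono sum_mono) (auto intro!: mult_left_mono simp del: mult_1_right)
  also have "\<dots> \<le> (2 * L) / (2 * L)"
    using sum_measure_tagged_subset_le[OF p sub int] L
    by (intro divide_right_mono) auto
  finally have "(\<Sum>v\<in>S. \<bar>s v\<bar>) \<le> 1" using L by simp
  then have *: "L * q (\<Sum>v\<in>S. s v *\<^sub>R v) \<le> 4 * c" using block unfolding block_def by blast
  have "(\<Sum>(x, K)\<in>p'. measure lborel K *\<^sub>R g x)
      = (\<Sum>v\<in>S. (\<Sum>(x, K)\<in>p'. measure lborel K * \<phi> v x) *\<^sub>R v)"
    unfolding g scaleR_sum_left scaleR_sum_right case_prod_beta
    by (subst sum.swap) simp
  also have "\<dots> = (2 * L) *\<^sub>R (\<Sum>v\<in>S. s v *\<^sub>R v)"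
    unfolding scaleR_sum_right s_def using L by (intro sum.cong) auto
  finally show ?thesis using * L by (simp add: q_scaleR)
qed

lemma block_riemann_sum_bound:
  assumes p: "p tagged_division_of {a..b}" "\<forall>(x, K)\<in>p. measure lborel K < 1"
  shows "q (\<Sum>(x, K)\<in>p. measure lborel K *\<^sub>R g x) \<le> \<kappa> * (\<kappa> * (\<epsilon> + \<epsilon>) + 8 * c)"
proof -
  define h where "h = (\<lambda>(x, K :: real set). measure lborel K *\<^sub>R g x)"
  \<comment> \<open>Intervals across the left end, across the right end, and inside the support. The
    set differences keep an interval across both ends from being counted twice.\<close>
  define A where "A = {(x, K) \<in> p. m - L \<in> interior K}"
  define B where "B = {(x, K) \<in> p. m + L \<in> interior K} - A"
  define D where "D = {(x, K) \<in> p. K \<subseteq> {m - L..m + L}} - A - B"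
  have fin: "finite p" using p by blast
  have sub: "A \<subseteq> p" "B \<subseteq> p" "D \<subseteq> p" unfolding A_def B_def D_def by auto
  have "h z = 0" if "z \<in> p - (A \<union> B \<union> D)" for z
  proof -
    obtain x K where z: "z = (x, K)" by fastforce
    have xK: "(x, K) \<in> p" using that z by auto
    obtain c d where K: "K = {c..d}" "c \<le> x" "x \<le> d" using measure_lborel_tagged[OF p(1) xK] by metis
    have "m - L \<notin> interior K" "m + L \<notin> interior K" "\<not> K \<subseteq> {m - L..m + L}"
      using that z xK unfolding A_def B_def D_def by auto
    \<comment> \<open>An interval that crosses neither end and is not inside has its tag where
      \<open>g\<close> vanishes.\<close>
    then have "x \<le> m - L \<or> x \<ge> m + L" using K by auto
    then show ?thesis using block_outside by (simp add: h_def z)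
  qed
  then have "sum h p = sum h (A \<union> B \<union> D)" using sub fin by (intro sum.mono_neutral_right) auto
  also have "\<dots> = sum h (A \<union> B) + sum h D"
    using sub by (intro sum.union_disjoint finite_subset[OF _ fin]) (auto simp: D_def)
  also have "sum h (A \<union> B) = sum h A + sum h B"
    using sub by (intro sum.union_disjoint finite_subset[OF _ fin]) (auto simp: B_def)
  finally have split: "sum h p = (sum h A + sum h B) + sum h D" .
  have "q (sum h A) \<le> \<epsilon>"
    unfolding h_def by (rule block_protruding_term[OF p sub(1), where z = "m - L"]) (auto simp: A_def)
  moreover have "q (sum h B) \<le> \<epsilon>"
    unfolding h_def by (rule block_protruding_term[OF p sub(2), where z = "m + L"]) (auto simp: B_def)
  moreover have "q (sum h D) \<le> 8 * c"
    unfolding h_def by (rule block_inner_terms[OF p(1) sub(3)]) (auto simp: D_def)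
  ultimately have "q (sum h p) \<le> \<kappa> * (\<kappa> * (\<epsilon> + \<epsilon>) + 8 * c)"
    unfolding split by (intro q_triangle_le)
  then show ?thesis by (simp add: h_def)
qed

end


section \<open>The counterexample\<close>

lemma counterexample_exists:
  assumes nlc: "\<not> locally_convex (quasi_norm_topology q)"
  shows "\<exists>f :: real \<Rightarrow> 'a.
    continuous_map (top_of_set {0..1}) (quasi_norm_topology q) f \<and>
    riemann_integrable (quasi_norm_topology q) f 0 1 \<and>
    \<not> bounded_on_square q (Ave (quasi_norm_topology q) f) \<and>
    \<not> separately_continuous_on_square (quasi_norm_topology q) (Ave (quasi_norm_topology q) f)"
proof -
  let ?T = "quasi_norm_topology q"
  \<comment> \<open>The centres \<open>m k\<close> decay by a factor of at least 8, which keeps the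
    supports apart. The growth \<open>2 ^ k\<close> of the averages only worsens the rate to
    \<open>\<theta> = 1 / (4 * \<kappa>)\<close>, still good enough for
    \<open>q_geometric_tail\<close>. \<open>C\<close> is the constant of
    \<open>block_riemann_sum_bound\<close> when \<epsilon> and \<open>c\<close> are at most
    \<open>\<theta> ^ k\<close>.\<close>
  define \<rho> where "\<rho> = 1 / (8 * \<kappa>)"
  define \<theta> where "\<theta> = 2 * \<rho>"
  define m where "m k = \<rho> ^ Suc k" for k :: nat
  define c where "c k = 2 ^ k * m k" for k :: nat
  define C where "C = \<kappa> * (\<kappa> * 2 + 8)"
  have \<rho>: "0 < \<rho>" "\<rho> \<le> 1 / 8" using \<kappa>_ge_1 by (auto simp: \<rho>_def field_simps)
  have \<theta>: "0 \<le> \<theta>" "\<kappa> * \<theta> \<le> 1 / 2" using \<rho> \<kappa>_ge_1 by (auto simp: \<theta>_def \<rho>_def)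
  have C: "C \<ge> 1"
    using \<kappa>_ge_1 mult_mono[of 1 \<kappa> 1 "\<kappa> * 2 + 8"] by (simp add: C_def)
  have m_pos: "m k > 0" for k using \<rho> by (simp add: m_def)
  have m_step: "m j \<le> m k / 8" if "k < j" for j k
  proof -
    have "m j \<le> \<rho> ^ Suc (Suc k)"
      unfolding m_def using that \<rho> by (intro power_decreasing) auto
    also have "\<dots> = \<rho> * m k" by (simp add: m_def)
    also have "\<dots> \<le> 1 / 8 * m k" using \<rho> m_pos[of k] by (intro mult_right_mono) auto
    finally show ?thesis by simp
  qed
  have "m 0 \<le> 1 / 8" using \<rho> by (simp add: m_def)
  then have m_le: "m k \<le> 1 / 8" for k
    using m_step[of 0 k] by (cases "k = 0") auto
  have m_lim: "m \<longlonglongrightarrow> 0"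
    unfolding m_def [abs_def] using \<rho> by (intro LIMSEQ_Suc LIMSEQ_power_zero) auto
  have c_pos: "c k > 0" for k using m_pos by (simp add: c_def)
  have m_le_c: "m k \<le> c k" for k
    using m_pos[of k] mult_right_mono[of 1 "2 ^ k" "m k"] by (simp add: c_def)
  have c_le: "c k \<le> \<theta> ^ k" for k
    using \<rho> mult_right_mono[of \<rho> 1 "(2 * \<rho>) ^ k"]
    by (simp add: c_def m_def \<theta>_def power_mult_distrib mult.left_commute)
  have c_le_C: "c k \<le> C * \<theta> ^ k" for k
    using c_le[of k] C \<theta> mult_right_mono[of 1 C "\<theta> ^ k"] by simp
  have "\<forall>k. \<exists>L S \<phi> X. block (c k) (m k) (m k) L S \<phi> X"
    using block_exists[OF nlc] m_pos c_pos by blast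
  then obtain L S \<phi> X where block: "\<And>k. block (c k) (m k) (m k) (L k) (S k) (\<phi> k) (X k)"
    by metis
  define g where "g k t = (\<Sum>v\<in>S k. \<phi> k v t *\<^sub>R v)" for k t
  \<comment> \<open>Sums over infinite sets would be 0 by convention, but \<open>f_eq\<close> below
    shows that only finitely many blocks are nonzero at each \<open>t\<close>.\<close>
  define f where "f t = (\<Sum>k | g k t \<noteq> 0. g k t)" for t
  note blk = block c_pos m_pos g_def
  have L: "0 < L k" "L k \<le> m k / 2" for k using block[of k] unfolding block_def by auto
  \<comment> \<open>Since \<open>L k \<le> m k / 2\<close>, the k-th block lives between
    \<open>m k / 2\<close> and \<open>3 / 2 * m k\<close>.\<close>
  have X0: "X k v t = 0" if "v \<in> S k" "t \<le> m k / 2 \<or> t \<ge> 3 / 2 * m k" for k v t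
  proof -
    have "t \<le> m k - L k \<or> t \<ge> m k + L k" using that(2) L[of k] by linarith
    then show ?thesis using block[of k] that(1) unfolding block_def by blast
  qed
  have g0: "g k t = 0" if "t \<le> m k / 2 \<or> t \<ge> 3 / 2 * m k" for k t
    using that L[of k] by (intro block_outside[OF blk]) linarith
  have g_le: "q (g k t) \<le> C * \<theta> ^ k" for k t
    using block_le[OF blk, of k t] m_le_c[of k] c_le_C[of k] by linarith
  have f_eq: "\<exists>N. \<forall>n\<ge>N. f t = (\<Sum>k<n. g k t)" for t
  proof -
    have "\<exists>N. \<forall>k\<ge>N. g k t = 0"
    proof (cases "t \<le> 0")
      case True
      then have "t \<le> m k / 2" for k using m_pos[of k] by linarith
      then show ?thesis using g0 by blast
    next
      case False
      then have "\<forall>\<^sub>F k in sequentially. m k < 2 / 3 * t"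
        using m_lim by (intro order_tendstoD) auto
      then obtain N where N: "\<And>k. k \<ge> N \<Longrightarrow> m k < 2 / 3 * t"
        by (auto simp: eventually_sequentially)
      then have "g k t = 0" if "k \<ge> N" for k using N[OF that] by (intro g0) simp
      then show ?thesis by blast
    qed
    then obtain N where N: "\<And>k. k \<ge> N \<Longrightarrow> g k t = 0" by blast
    have "f t = (\<Sum>k<n. g k t)" if "n \<ge> N" for n
      unfolding f_def
    proof (rule sum.mono_neutral_left)
      show "{k. g k t \<noteq> 0} \<subseteq> {..<n}" using N that by (metis (mono_tags, lifting) lessThan_iff
            mem_Collect_eq not_le order_trans subsetI)
    qed auto
    then show ?thesis by blast
  qed
  have f0: "f 0 = 0"
    unfolding f_def using g0[of 0] m_pos by (intro sum.neutral ballI) (simp add: less_imp_le)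
  have cont: "continuous_map (top_of_set {0..1}) ?T f"
    unfolding continuous_map_atin
  proof
    fix x :: real assume "x \<in> topspace (top_of_set {0..1})"
    have "qlim f (f x) (at x within {0..1})"
    proof (rule qlim_dominated_sum[where u = g and C = C])
      show "qlim (g k) (g k x) (at x within {0..1})" for k by (rule block_qlim[OF blk])
    qed (use g_le \<theta> C f_eq in auto)
    moreover have "atin (top_of_set {0..1}) x = at x within {0..1}"
      using \<open>x \<in> _\<close>
      by (auto simp: atin_subtopology_within filter_eq_iff eventually_atin_within eventually_at_topological)
    ultimately show "limitin ?T f (f x) (atin (top_of_set {0..1}) x)"
      by (simp add: limitin_iff_qlim)
  qed
  \<comment> \<open>This is the integral of the k-th block from 0 to \<open>b\<close>, as the
    primitives vanish at 0.\<close>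
  define J where "J k b = (\<Sum>v\<in>S k. X k v b *\<^sub>R v)" for k b
  have integral: "has_riemann_integral ?T f I 0 b"
    if b: "b \<ge> 0" and le: "\<And>k. q (J k b) \<le> C * \<theta> ^ k"
      and I: "\<exists>N. \<forall>n\<ge>N. I = (\<Sum>k<n. J k b)" for I b
    unfolding has_riemann_integral_def limitin_iff_qlim
  proof (rule qlim_dominated_sum[where u = "\<lambda>k p. \<Sum>(x, K)\<in>p. measure lborel K *\<^sub>R g k x"
        and l = "\<lambda>k. J k b" and C = C])
    show "qlim (\<lambda>p. \<Sum>(x, K)\<in>p. measure lborel K *\<^sub>R g k x) (J k b) (mesh_filter 0 b)" for k
    proof -
      have "J k b = (\<Sum>v\<in>S k. (X k v b - X k v 0) *\<^sub>R v)"
        unfolding J_def using X0[of _ k 0] m_pos[of k] by (intro sum.cong) auto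
      then show ?thesis using block_riemann_sums[OF blk b, of k] by simp
    qed
    show "\<forall>\<^sub>F p in mesh_filter 0 b. \<forall>k. q (\<Sum>(x, K)\<in>p. measure lborel K *\<^sub>R g k x) \<le> C * \<theta> ^ k"
      unfolding eventually_mesh_filter
    proof (intro exI[of _ "1 :: real"] conjI allI impI)
      fix p k assume p: "p tagged_division_of {0..b} \<and> (\<forall>(x, K)\<in>p. measure lborel K < 1)"
      have "q (\<Sum>(x, K)\<in>p. measure lborel K *\<^sub>R g k x) \<le> \<kappa> * (\<kappa> * (m k + m k) + 8 * c k)"
        using p by (intro block_riemann_sum_bound[OF blk]) auto
      also have "\<dots> \<le> \<kappa> * (\<kappa> * (\<theta> ^ k + \<theta> ^ k) + 8 * \<theta> ^ k)"
        using \<kappa>_ge_1 c_le[of k] m_le_c[of k] by (intro mult_left_mono add_mono) auto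
      also have "\<dots> = C * \<theta> ^ k" by (simp add: C_def algebra_simps)
      finally show "q (\<Sum>(x, K)\<in>p. measure lborel K *\<^sub>R g k x) \<le> C * \<theta> ^ k" .
    qed simp
    show "\<forall>\<^sub>F p in mesh_filter 0 b. \<exists>N. \<forall>n\<ge>N. (\<Sum>(x, K)\<in>p. measure lborel K *\<^sub>R f x)
        = (\<Sum>k<n. \<Sum>(x, K)\<in>p. measure lborel K *\<^sub>R g k x)"
      unfolding eventually_mesh_filter
    proof (intro exI[of _ "1 :: real"] conjI allI impI)
      fix p assume "p tagged_division_of {0..b} \<and> (\<forall>(x, K)\<in>p. measure lborel K < 1)"
      then have fin: "finite p" by blast
      \<comment> \<open>The number of blocks needed depends on the tag; a partition has finitely
        many tags, so the maximum works for the whole Riemann sum.\<close>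
      obtain N where N: "\<And>x n. n \<ge> N x \<Longrightarrow> f x = (\<Sum>k<n. g k x)" using f_eq by metis
      have "(\<Sum>(x, K)\<in>p. measure lborel K *\<^sub>R f x)
          = (\<Sum>k<n. \<Sum>(x, K)\<in>p. measure lborel K *\<^sub>R g k x)" if n: "n \<ge> Max (N ` fst ` p)" for n
      proof -
        have "(\<Sum>(x, K)\<in>p. measure lborel K *\<^sub>R f x)
            = (\<Sum>(x, K)\<in>p. \<Sum>k<n. measure lborel K *\<^sub>R g k x)"
        proof (intro sum.cong refl, clarify)
          fix x K assume "(x, K) \<in> p"
          then have "N x \<in> N ` fst ` p" by force
          then have "N x \<le> Max (N ` fst ` p)" using fin by (intro Max_ge) auto
          then have "f x = (\<Sum>k<n. g k x)" using n by (intro N) simp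
          then show "measure lborel K *\<^sub>R f x = (\<Sum>k<n. measure lborel K *\<^sub>R g k x)"
            by (simp add: scaleR_sum_right)
        qed
        then show ?thesis unfolding case_prod_beta by (subst sum.swap) simp
      qed
      then show "\<exists>N. \<forall>n\<ge>N. (\<Sum>(x, K)\<in>p. measure lborel K *\<^sub>R f x)
        = (\<Sum>k<n. \<Sum>(x, K)\<in>p. measure lborel K *\<^sub>R g k x)" by blast
    qed simp
  qed (use le I \<theta> C in auto)
  have J0: "J k b = 0" if "b \<le> m k / 2 \<or> b \<ge> 3 / 2 * m k" for k b
    unfolding J_def using X0 that by (intro sum.neutral) auto
  have integrable: "riemann_integrable ?T f 0 1"
  proof -
    \<comment> \<open>All supports end before 1, and each block has total integral 0.\<close>
    have "J k 1 = 0" for k using m_le[of k] by (intro J0) simp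
    then have "has_riemann_integral ?T f 0 0 1"
      using C \<theta> by (intro integral) auto
    then show ?thesis unfolding riemann_integrable_def by blast
  qed
  have ave: "q (Ave ?T f 0 (m n)) = 2 ^ n" for n
  proof -
    \<comment> \<open>At \<open>m n\<close> every other block is either completely passed or not yet
      reached, so the integral consists of the first half of block \<open>n\<close> alone.\<close>
    have J_other: "J k (m n) = 0" if "k \<noteq> n" for k
    proof (intro J0)
      show "m n \<le> m k / 2 \<or> m n \<ge> 3 / 2 * m k"
        using that m_step[of k n] m_step[of n k] m_pos[of k] m_pos[of n]
        by (cases "k < n") auto
    qed
    have J_n: "q (J n (m n)) = c n" using block[of n] unfolding block_def J_def by blast
    have "has_riemann_integral ?T f (J n (m n)) 0 (m n)"
    proof (rule integral)
      show "q (J k (m n)) \<le> C * \<theta> ^ k" for k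
        using J_other[of k] J_n c_le_C[of n] C \<theta> by (cases "k = n") auto
      have "(\<Sum>k<N. J k (m n)) = J n (m n)" if "N \<ge> Suc n" for N
        using that J_other by (subst sum.remove[of _ n]) auto
      then show "\<exists>N. \<forall>N'\<ge>N. J n (m n) = (\<Sum>k<N'. J k (m n))" by metis
    qed (use m_pos[of n] in simp)
    then have "riemann_integral ?T f 0 (m n) = J n (m n)" by (rule riemann_integral_eqI)
    then show ?thesis using m_pos[of n] J_n by (simp add: Ave_def q_scaleR c_def)
  qed
  have m_in: "m n \<in> {0..1}" for n using m_pos[of n] m_le[of n] by simp
  have "\<not> bounded_on_square q (Ave ?T f)"
  proof
    assume "bounded_on_square q (Ave ?T f)"
    then obtain B where B: "\<And>s t. s \<in> {0..1} \<Longrightarrow> t \<in> {0..1} \<Longrightarrow> q (Ave ?T f s t) \<le> B"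
      unfolding bounded_on_square_def bdd_above_def by fastforce
    obtain n where "B < 2 ^ n" using real_arch_pow[of 2 B] by auto
    then show False using B[of 0 "m n"] m_in[of n] ave[of n] by simp
  qed
  moreover have "\<not> separately_continuous_on_square ?T (Ave ?T f)"
  proof
    assume "separately_continuous_on_square ?T (Ave ?T f)"
    then have "limitin ?T (\<lambda>t. Ave ?T f 0 t) (Ave ?T f 0 0) (at 0 within {0..1})"
      unfolding separately_continuous_on_square_def by simp
    then have "\<forall>\<^sub>F t in at 0 within {0..1}. q (Ave ?T f 0 t - Ave ?T f 0 0) < 1"
      unfolding limitin_iff_qlim qlim_def by simp
    \<comment> \<open>The centres approach 0 without reaching it; along them the averages from 0
      have quasi-norm \<open>2 ^ n\<close>, whereas the value at \<open>(0, 0)\<close> is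
      \<open>f 0 = 0\<close>.\<close>
    moreover have "filterlim m (at 0 within {0..1}) sequentially"
      using m_lim m_in m_pos unfolding filterlim_at
      by (auto intro!: always_eventually simp: less_imp_neq[symmetric])
    ultimately have "\<forall>\<^sub>F n in sequentially. q (Ave ?T f 0 (m n) - Ave ?T f 0 0) < 1"
      by (rule eventually_compose_filterlim)
    moreover have "Ave ?T f 0 0 = 0" using f0 by (simp add: Ave_def)
    ultimately have "\<forall>\<^sub>F n in sequentially. (2 :: real) ^ n < 1" by (simp add: ave)
    moreover have "\<not> (2 :: real) ^ n < 1" for n by (simp add: not_less)
    ultimately show False by simp
  qed
  ultimately show ?thesis using cont integrable by blast
qed

end

theorem theorem1p5:
  fixes q :: "'a::real_vector \<Rightarrow> real"
  assumes "quasi_banach q"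
    and "\<not> locally_convex (quasi_norm_topology q)"
  shows "\<exists>f :: real \<Rightarrow> 'a.
    continuous_map (top_of_set {0..1}) (quasi_norm_topology q) f \<and>
    riemann_integrable (quasi_norm_topology q) f 0 1 \<and>
    \<not> bounded_on_square q (Ave (quasi_norm_topology q) f) \<and>
    \<not> separately_continuous_on_square (quasi_norm_topology q) (Ave (quasi_norm_topology q) f)"
proof -
  obtain \<kappa> where "quasi_norm_const q \<kappa>"
    using assms(1) unfolding quasi_banach_def quasi_norm_def quasi_norm_const_def by blast
  then show ?thesis using assms(2) by (rule quasi_norm_const.counterexample_exists)
qed

end
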